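(* Let $r,s\in\mathbb{R}$ with $r-s=1$. Let $(t_0,t_1)\in\mathbb{R}^2$ be a strategic pair for the classical string (the case $q=0$), i.e. there is a constant $c>0$ such that $$|\sin(k(t_0-t_1))|\ge\frac{c}{k},\qquad k=1,2,\ldots$$ Then $(t_0,t_1)$ is also a strategic pair for the loaded string provided that $q>0$ is sufficiently small; that is, there exists $q_0>0$ such that for every $q\in(0,q_0)$ the pair $(t_0,t_1)$ is strategic for the string with parameter $q$.
   Context: Function spaces: let $D$ be the vector space of finite linear combinations $\sum_k c_k\sin(kx)$, $c_k\in\mathbb{C}$, $k=1,2,\ldots$, on $(0,\pi)$. For $s\in\mathbb{R}$, equip $D$ with the norm $\|\sum_k c_k\sin(kx)\|_s^2:=\sum_k k^{2s}|c_k|^2$, and let $D^s$ be the completion of $D$ for $\|\cdot\|_s$. String with parameter $q\ge0$ (classical string if $q=0$, loaded string if $q>0$): the problem $y''-y_{xx}+qy=0$ in $\mathbb{R}\times(0,\pi)$, $y=0$ on $\mathbb{R}\times\{0,\pi\}$, $y(0)=y_0$, $y'(0)=y_1$ in $(0,\pi)$ (prime denotes the time derivative, $y(t)$ denotes $y(t,\cdot)$). Put $\omega_k:=\sqrt{k^2+q}$. For $\sigma\in\mathbb{R}$, $y_0\in D^\sigma$, $y_1\in D^{\sigma-1}$, its unique solution in $C(\mathbb{R},D^\sigma)\cap C^1(\mathbb{R},D^{\sigma-1})\cap C^2(\mathbb{R},D^{\sigma-2})$ is $y(t,x)=\sum_{k\ge1}(a_ke^{i\omega_kt}+b_ke^{-i\omega_kt})\sin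 kx$, where the complex numbers $a_k,b_k$ are determined by the initial data: $y_0=\sum_k(a_k+b_k)\sin kx$, $y_1=\sum_k i\omega_k(a_k-b_k)\sin kx$. Strategic pair: given real numbers $s\le r$ and $q\ge0$, a pair $(t_0,t_1)\in\mathbb{R}^2$ is called strategic for the string with parameter $q$ if there is a constant $C>0$ such that $\|y_0\|_s+\|y_1\|_{s-1}\le C(\|y(t_0)\|_r+\|y(t_1)\|_r)$ for all initial data $(y_0,y_1)\in D^r\times D^{r-1}$, where $y$ is the corresponding solution. *)

theory Defs
  imports "HOL-Analysis.Analysis"
begin

text \<open>
  A formal series \<open>\<Sum>k\<ge>1. c k * sin (k x)\<close> is represented by its coefficient sequence
  \<open>c :: nat \<Rightarrow> complex\<close>.  The index \<open>0\<close> is not used, so we require \<open>c 0 = 0\<close>.  The Dirichlet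
  conditions at \<open>0\<close> and \<open>\<pi>\<close> are built into the sine basis.
\<close>

definition sine_polys :: "(nat \<Rightarrow> complex) set" where
  "sine_polys = {c. c 0 = 0 \<and> finite {k. c k \<noteq> 0}}"

definition sine_poly_fun :: "(nat \<Rightarrow> complex) \<Rightarrow> real \<Rightarrow> complex" where
  "sine_poly_fun c x = (\<Sum>k | c k \<noteq> 0. c k * of_real (sin (real k * x)))"

text \<open>
  \<open>Dspace s\<close> with \<open>Dnorm s\<close> is the concrete model of the completion \<open>D\<^sup>s\<close>; this is justified by
  the lemmas \<open>inj_on_sine_poly_fun\<close> (\<open>sine_polys\<close> is the space of functions \<open>D\<close>),
  \<open>sine_polys_subset_Dspace\<close>, \<open>sine_polys_dense\<close> and \<open>Dspace_complete\<close> below.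
  All these completions are realised inside the same space of sequences, so
  \<open>Dspace r \<subseteq> Dspace s\<close> for \<open>s \<le> r\<close>.  The term for \<open>k = 0\<close> vanishes.
\<close>

definition Dspace :: "real \<Rightarrow> (nat \<Rightarrow> complex) set" where
  "Dspace s = {c. c 0 = 0 \<and> summable (\<lambda>k. real k powr (2 * s) * (cmod (c k))\<^sup>2)}"

definition Dnorm :: "real \<Rightarrow> (nat \<Rightarrow> complex) \<Rightarrow> real" where
  "Dnorm s c = sqrt (\<Sum>k. real k powr (2 * s) * (cmod (c k))\<^sup>2)"

definition D_continuous :: "real \<Rightarrow> (real \<Rightarrow> nat \<Rightarrow> complex) \<Rightarrow> bool" where
  "D_continuous s f \<longleftrightarrow> (\<forall>t. f t \<in> Dspace s) \<and>
     (\<forall>t. ((\<lambda>\<tau>. Dnorm s (\<lambda>k. f \<tau> k - f t k)) \<longlongrightarrow> 0) (at t))"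

definition D_has_derivative ::
    "real \<Rightarrow> (real \<Rightarrow> nat \<Rightarrow> complex) \<Rightarrow> (real \<Rightarrow> nat \<Rightarrow> complex) \<Rightarrow> bool" where
  "D_has_derivative s f g \<longleftrightarrow> (\<forall>t. f t \<in> Dspace s) \<and> (\<forall>t. g t \<in> Dspace s) \<and>
     (\<forall>t. ((\<lambda>h. Dnorm s (\<lambda>k. (f (t + h) k - f t k) / of_real h - g t k)) \<longlongrightarrow> 0) (at 0))"

definition D_xx :: "(nat \<Rightarrow> complex) \<Rightarrow> nat \<Rightarrow> complex" where
  "D_xx c k = - (of_nat k)\<^sup>2 * c k"

text \<open>
  \<open>y \<in> C(\<real>, D\<^sup>\<sigma>) \<inter> C\<^sup>1(\<real>, D\<^sup>\<sigma>\<^sup>-\<^sup>1) \<inter> C\<^sup>2(\<real>, D\<^sup>\<sigma>\<^sup>-\<^sup>2)\<close> solves \<open>y'' - y\<^sub>x\<^sub>x + q y = 0\<close> with initial data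
  \<open>(y0, y1)\<close>; \<open>v\<close> and \<open>w\<close> are the first and second time derivatives.  For \<open>q \<ge> 0\<close> and
  \<open>y0 \<in> D\<^sup>\<sigma>\<close>, \<open>y1 \<in> D\<^sup>\<sigma>\<^sup>-\<^sup>1\<close> there is exactly one solution, see \<open>string_solution_iff\<close> below.
\<close>

definition string_solution ::
    "real \<Rightarrow> real \<Rightarrow> (nat \<Rightarrow> complex) \<Rightarrow> (nat \<Rightarrow> complex) \<Rightarrow> (real \<Rightarrow> nat \<Rightarrow> complex) \<Rightarrow> bool" where
  "string_solution q \<sigma> y0 y1 y \<longleftrightarrow> (\<exists>v w.
     D_continuous \<sigma> y \<and>
     D_has_derivative (\<sigma> - 1) y v \<and> D_continuous (\<sigma> - 1) v \<and>
     D_has_derivative (\<sigma> - 2) v w \<and> D_continuous (\<sigma> - 2) w \<and>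
     (\<forall>t k. w t k - D_xx (y t) k + of_real q * y t k = 0) \<and>
     y 0 = y0 \<and> v 0 = y1)"

definition strategic_pair :: "real \<Rightarrow> real \<Rightarrow> real \<Rightarrow> real \<Rightarrow> real \<Rightarrow> bool" where
  "strategic_pair r s q t0 t1 \<longleftrightarrow> (\<exists>C>0. \<forall>y0 \<in> Dspace r. \<forall>y1 \<in> Dspace (r - 1). \<forall>y.
     string_solution q r y0 y1 y \<longrightarrow>
     Dnorm s y0 + Dnorm (s - 1) y1 \<le> C * (Dnorm r (y t0) + Dnorm r (y t1)))"


subsection \<open>\<open>Dspace s\<close> is the completion of the sine polynomials\<close>

lemma inj_on_sine_poly_fun:
  "inj_on (\<lambda>c. restrict (sine_poly_fun c) {0<..<pi}) sine_polys"
proof (rule inj_onI)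
  fix c d assume c: "c \<in> sine_polys" and d: "d \<in> sine_polys"
    and eq: "restrict (sine_poly_fun c) {0<..<pi} = restrict (sine_poly_fun d) {0<..<pi}"
  have "finite ({k. c k \<noteq> 0} \<union> {k. d k \<noteq> 0})"
    using c d by (auto simp: sine_polys_def)
  then obtain N where N: "\<And>k. k \<in> {k. c k \<noteq> 0} \<union> {k. d k \<noteq> 0} \<Longrightarrow> k < N"
    by (meson finite_nat_set_iff_bounded)
  define e where "e k = c k - d k" for k
  define p :: "nat \<Rightarrow> complex" where
    "p j = (if N \<le> j then e (j - N) else - e (N - j))" for j
  have e0: "e 0 = 0" using c d by (auto simp: e_def sine_polys_def)
  have sum_e: "(\<Sum>k<N. e k * of_real (sin (real k * x))) = 0" if "x \<in> {0<..<pi}" for x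
  proof -
    have 1: "sine_poly_fun c x = (\<Sum>k<N. c k * of_real (sin (real k * x)))"
      unfolding sine_poly_fun_def by (rule sum.mono_neutral_left) (use N in auto)
    have 2: "sine_poly_fun d x = (\<Sum>k<N. d k * of_real (sin (real k * x)))"
      unfolding sine_poly_fun_def by (rule sum.mono_neutral_left) (use N in auto)
    have "sine_poly_fun c x = sine_poly_fun d x"
      using fun_cong[OF eq, of x] that by simp
    then show ?thesis
      unfolding 1 2 by (simp add: e_def left_diff_distrib sum_subtractf)
  qed
  have root: "(\<Sum>j\<le>2 * N. p j * cis x ^ j) = 0" if x: "x \<in> {0<..<pi}" for x
  proof -
    have "(\<Sum>j\<le>2 * N. p j * cis x ^ j) =
        (\<Sum>j<N. p j * cis x ^ j) + (\<Sum>j\<in>{N..2 * N}. p j * cis x ^ j)"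
      by (subst sum.union_disjoint[symmetric]) (auto intro!: sum.cong)
    also have "(\<Sum>j<N. p j * cis x ^ j) = (\<Sum>k\<in>{1..N}. - e k * cis x ^ (N - k))"
      by (rule sum.reindex_bij_witness[of _ "\<lambda>k. N - k" "\<lambda>j. N - j"]) (auto simp: p_def)
    also have "\<dots> = (\<Sum>k\<le>N. - e k * cis x ^ (N - k))"
      by (rule sum.mono_neutral_left) (use e0 in \<open>auto simp: not_le\<close>)
    also have "(\<Sum>j\<in>{N..2 * N}. p j * cis x ^ j) = (\<Sum>k\<le>N. e k * cis x ^ (N + k))"
      by (rule sum.reindex_bij_witness[of _ "\<lambda>k. N + k" "\<lambda>j. j - N"]) (auto simp: p_def)
    also have "(\<Sum>k\<le>N. - e k * cis x ^ (N - k)) + (\<Sum>k\<le>N. e k * cis x ^ (N + k)) =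
        (\<Sum>k\<le>N. 2 * \<i> * cis x ^ N * (e k * of_real (sin (real k * x))))"
      unfolding sum.distrib[symmetric]
    proof (rule sum.cong)
      fix k assume "k \<in> {..N}"
      then have "k \<le> N" by simp
      have 1: "cis x ^ (N - k) = cis x ^ N * cis (- (real k * x))"
        using \<open>k \<le> N\<close> by (simp add: Complex.DeMoivre cis_mult of_nat_diff algebra_simps)
      have 2: "cis x ^ (N + k) = cis x ^ N * cis (real k * x)"
        by (simp add: Complex.DeMoivre cis_mult algebra_simps)
      have 3: "cis (real k * x) - cis (- (real k * x)) = 2 * \<i> * of_real (sin (real k * x))"
        by (simp add: complex_eq_iff)
      have "- e k * cis x ^ (N - k) + e k * cis x ^ (N + k) =
          e k * cis x ^ N * (cis (real k * x) - cis (- (real k * x)))"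
        unfolding 1 2 by (simp add: algebra_simps)
      then show "- e k * cis x ^ (N - k) + e k * cis x ^ (N + k) =
          2 * \<i> * cis x ^ N * (e k * of_real (sin (real k * x)))"
        unfolding 3 by (simp add: algebra_simps)
    qed simp
    also have "\<dots> = 2 * \<i> * cis x ^ N * (\<Sum>k<N. e k * of_real (sin (real k * x)))"
    proof -
      have "c N = 0" "d N = 0" using N[of N] by auto
      then have "e N = 0" by (simp add: e_def)
      then show ?thesis
        by (simp add: sum_distrib_left lessThan_Suc_atMost[symmetric])
    qed
    finally show ?thesis using sum_e[OF x] by simp
  qed
  have "inj_on cis {0<..<pi}"
    by (rule inj_onI) (auto simp: complex_eq_iff intro: cos_inj_pi)
  then have inf: "infinite (cis ` {0<..<pi})"
    by (simp add: finite_image_iff)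
  have "cis ` {0<..<pi} \<subseteq> {z. (\<Sum>j\<le>2 * N. p j * z ^ j) = 0}"
    using root by auto
  then have infr: "infinite {z. (\<Sum>j\<le>2 * N. p j * z ^ j) = 0}"
    using inf finite_subset by blast
  have p0: "p j = 0" if "j \<le> 2 * N" for j
    using polyfun_finite_roots[of p "2 * N"] infr that by auto
  have "e k = 0" for k
  proof (cases "k < N")
    case True
    then show ?thesis using p0[of "N + k"] by (simp add: p_def)
  next
    case False
    then have "c k = 0" "d k = 0" using N[of k] by auto
    then show ?thesis by (simp add: e_def)
  qed
  then show "c = d" by (auto simp: e_def)
qed

lemma DspaceD: "c \<in> Dspace s \<Longrightarrow> summable (\<lambda>k. real k powr (2 * s) * (cmod (c k))\<^sup>2)"
  "c \<in> Dspace s \<Longrightarrow> c 0 = 0"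
  by (auto simp: Dspace_def)

lemma Dspace_dominated:
  assumes "g \<in> Dspace s" and "\<And>k. cmod (f k) \<le> M * cmod (g k)"
  shows "f \<in> Dspace s"
proof -
  have *: "real k powr (2 * s) * (cmod (f k))\<^sup>2 \<le> M\<^sup>2 * (real k powr (2 * s) * (cmod (g k))\<^sup>2)" for k
  proof -
    have "(cmod (f k))\<^sup>2 \<le> (M * cmod (g k))\<^sup>2"
      by (intro power_mono assms(2)) simp
    then have "real k powr (2 * s) * (cmod (f k))\<^sup>2 \<le> real k powr (2 * s) * (M * cmod (g k))\<^sup>2"
      by (intro mult_left_mono) auto
    then show ?thesis by (simp add: power_mult_distrib mult_ac)
  qed
  have "summable (\<lambda>k. real k powr (2 * s) * (cmod (f k))\<^sup>2)"
    by (rule summable_comparison_test'[OF summable_mult[OF DspaceD(1)[OF assms(1)], of "M\<^sup>2"], of 0])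
       (use * in simp)
  moreover have "f 0 = 0"
    using assms(2)[of 0] DspaceD(2)[OF assms(1)] by simp
  ultimately show ?thesis by (simp add: Dspace_def)
qed

lemma Dspace_norm_add:
  assumes "f \<in> Dspace s" "g \<in> Dspace s"
  shows "(\<lambda>k. of_real (cmod (f k) + cmod (g k))) \<in> Dspace s"
proof -
  have *: "real k powr (2 * s) * (cmod (f k) + cmod (g k))\<^sup>2 \<le>
      2 * (real k powr (2 * s) * (cmod (f k))\<^sup>2 + real k powr (2 * s) * (cmod (g k))\<^sup>2)" for k
  proof -
    have "(cmod (f k) + cmod (g k))\<^sup>2 \<le> 2 * ((cmod (f k))\<^sup>2 + (cmod (g k))\<^sup>2)"
      using zero_le_power2[of "cmod (f k) - cmod (g k)"]
      by (simp add: power2_sum power2_diff)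
    then have "real k powr (2 * s) * (cmod (f k) + cmod (g k))\<^sup>2 \<le>
        real k powr (2 * s) * (2 * ((cmod (f k))\<^sup>2 + (cmod (g k))\<^sup>2))"
      by (intro mult_left_mono) auto
    then show ?thesis by (simp add: algebra_simps)
  qed
  have "summable (\<lambda>k. real k powr (2 * s) * (cmod (f k) + cmod (g k))\<^sup>2)"
    by (rule summable_comparison_test'[OF summable_mult[OF summable_add[OF
          DspaceD(1)[OF assms(1)] DspaceD(1)[OF assms(2)]], of 2], of 0])
       (use * in simp)
  then show ?thesis
    using DspaceD(2)[OF assms(1)] DspaceD(2)[OF assms(2)]
    by (simp add: Dspace_def del: of_real_add)
qed

lemma Dspace_diff:
  assumes "f \<in> Dspace s" "g \<in> Dspace s"
  shows "(\<lambda>k. f k - g k) \<in> Dspace s"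
  by (rule Dspace_dominated[OF Dspace_norm_add[OF assms], where M = 1])
     (simp del: of_real_add add: norm_triangle_ineq4)

lemma sine_polys_subset_Dspace: "sine_polys \<subseteq> Dspace s"
  by (auto simp: sine_polys_def Dspace_def intro!: summable_finite)

lemma Dnorm_sine_poly:
  assumes "c \<in> sine_polys"
  shows "(Dnorm s c)\<^sup>2 = (\<Sum>k | c k \<noteq> 0. real k powr (2 * s) * (cmod (c k))\<^sup>2)"
proof -
  have "(\<Sum>k. real k powr (2 * s) * (cmod (c k))\<^sup>2) =
      (\<Sum>k | c k \<noteq> 0. real k powr (2 * s) * (cmod (c k))\<^sup>2)"
    by (rule suminf_finite) (use assms in \<open>auto simp: sine_polys_def\<close>)
  then show ?thesis by (simp add: Dnorm_def sum_nonneg)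
qed

lemma Dnorm_nonneg [simp]: "0 \<le> Dnorm s c" if "c \<in> Dspace s"
  unfolding Dnorm_def by (intro real_sqrt_ge_zero suminf_nonneg DspaceD(1) that) auto

lemma cmod_le_Dnorm:
  assumes "c \<in> Dspace s" "k \<ge> 1"
  shows "cmod (c k) \<le> real k powr (- s) * Dnorm s c"
proof -
  have "(\<Sum>j\<in>{k}. real j powr (2 * s) * (cmod (c j))\<^sup>2) \<le> (\<Sum>j. real j powr (2 * s) * (cmod (c j))\<^sup>2)"
    by (rule sum_le_suminf[OF DspaceD(1)[OF assms(1)]]) auto
  then have "real k powr (2 * s) * (cmod (c k))\<^sup>2 \<le> (\<Sum>j. real j powr (2 * s) * (cmod (c j))\<^sup>2)"
    by simp
  moreover have "real k powr (2 * s) = (real k powr s)\<^sup>2"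
    by (simp add: power2_eq_square flip: powr_add)
  ultimately have "(real k powr s * cmod (c k))\<^sup>2 \<le> (\<Sum>j. real j powr (2 * s) * (cmod (c j))\<^sup>2)"
    by (simp add: power_mult_distrib)
  then have "real k powr s * cmod (c k) \<le> Dnorm s c"
    unfolding Dnorm_def by (rule real_le_rsqrt)
  then have "real k powr (- s) * (real k powr s * cmod (c k)) \<le> real k powr (- s) * Dnorm s c"
    by (intro mult_left_mono) auto
  moreover have "real k powr (- s) * real k powr s = 1"
    using assms(2) by (simp flip: powr_add)
  ultimately show ?thesis by (simp flip: mult.assoc)
qed

lemma Dnorm_tendsto_dominated:
  assumes lim: "\<And>k. ((\<lambda>h. f h k) \<longlongrightarrow> 0) F"
    and bound: "\<And>h k. cmod (f h k) \<le> M * cmod (g k)"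
    and g: "g \<in> Dspace s" and F: "F \<noteq> bot"
  shows "((\<lambda>h. Dnorm s (f h)) \<longlongrightarrow> 0) F"
proof -
  let ?a = "\<lambda>k h. real k powr (2 * s) * (cmod (f h k))\<^sup>2"
  let ?M = "\<lambda>k. M\<^sup>2 * (real k powr (2 * s) * (cmod (g k))\<^sup>2)"
  have "((\<lambda>h. ?a k h) \<longlongrightarrow> real k powr (2 * s) * (cmod 0)\<^sup>2) F" for k
    by (intro tendsto_intros lim)
  then have 1: "((\<lambda>h. ?a k h) \<longlongrightarrow> 0) F" for k by simp
  have "?a k h \<le> ?M k" for k h
  proof -
    have "(cmod (f h k))\<^sup>2 \<le> (M * cmod (g k))\<^sup>2"
      by (intro power_mono bound) simp
    then have "?a k h \<le> real k powr (2 * s) * (M * cmod (g k))\<^sup>2"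
      by (intro mult_left_mono) auto
    then show ?thesis by (simp add: power_mult_distrib mult_ac)
  qed
  then have 2: "eventually (\<lambda>(k, h). norm (?a k h) \<le> ?M k) (at_top \<times>\<^sub>F F)"
    by (intro always_eventually) auto
  have "((\<lambda>h. \<Sum>k. ?a k h) \<longlongrightarrow> (\<Sum>k. 0)) F"
    using tannerys_theorem[OF 1 2 summable_mult[OF DspaceD(1)[OF g]] F] by blast
  then have "((\<lambda>h. sqrt (\<Sum>k. ?a k h)) \<longlongrightarrow> sqrt 0) F"
    by (intro tendsto_real_sqrt) simp
  then show ?thesis by (simp add: Dnorm_def)
qed

lemma sine_polys_dense:
  assumes "c \<in> Dspace s"
  shows "\<exists>p. (\<forall>n. p n \<in> sine_polys) \<and> (\<lambda>n. Dnorm s (\<lambda>k. c k - p n k)) \<longlonglongrightarrow> 0"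
proof (intro exI conjI allI)
  let ?p = "\<lambda>n k. if k < n then c k else 0 :: complex"
  show "?p n \<in> sine_polys" for n :: nat
    using DspaceD(2)[OF assms] by (auto simp: sine_polys_def)
  have "(\<lambda>n. c k - ?p n k) \<longlonglongrightarrow> 0" for k
    by (rule tendsto_eventually, rule eventually_mono[OF eventually_gt_at_top[of k]]) simp
  then show "(\<lambda>n. Dnorm s (\<lambda>k. c k - ?p n k)) \<longlonglongrightarrow> 0"
    by (intro Dnorm_tendsto_dominated[where M = 1 and g = c]) (use assms in auto)
qed

lemma Dspace_complete:
  assumes X: "\<And>n. X n \<in> Dspace s"
    and Cauchy: "\<And>\<epsilon>. \<epsilon> > 0 \<Longrightarrow> \<exists>N. \<forall>m\<ge>N. \<forall>n\<ge>N. Dnorm s (\<lambda>k. X m k - X n k) < \<epsilon>"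
  shows "\<exists>c\<in>Dspace s. (\<lambda>n. Dnorm s (\<lambda>k. X n k - c k)) \<longlonglongrightarrow> 0"
proof -
  have "convergent (\<lambda>n. X n k)" for k
  proof (cases "k \<ge> 1")
    case True
    have "Cauchy (\<lambda>n. X n k)"
    proof (rule CauchyI)
      fix e :: real assume "e > 0"
      have pos: "real k powr s > 0" using True by simp
      from Cauchy[of "e * real k powr s"] obtain N where
        N: "\<And>m n. m \<ge> N \<Longrightarrow> n \<ge> N \<Longrightarrow> Dnorm s (\<lambda>k. X m k - X n k) < e * real k powr s"
        using \<open>e > 0\<close> pos by (metis mult_pos_pos)
      have "norm (X m k - X n k) < e" if "m \<ge> N" "n \<ge> N" for m n
      proof -
        have "cmod (X m k - X n k) \<le> real k powr (- s) * Dnorm s (\<lambda>k. X m k - X n k)"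
          using cmod_le_Dnorm[OF Dspace_diff[OF X X] True] by simp
        also have "\<dots> < real k powr (- s) * (e * real k powr s)"
          using N[OF that] True by (intro mult_strict_left_mono) auto
        also have "\<dots> = e"
          using pos by (simp add: powr_minus field_simps)
        finally show ?thesis .
      qed
      then show "\<exists>M. \<forall>m\<ge>M. \<forall>n\<ge>M. norm (X m k - X n k) < e" by blast
    qed
    then show ?thesis by (rule Cauchy_convergent)
  next
    case False
    then have "k = 0" by simp
    then show ?thesis using DspaceD(2)[OF X] by (simp add: convergent_const)
  qed
  then obtain c where c: "\<And>k. (\<lambda>n. X n k) \<longlonglongrightarrow> c k"
    unfolding convergent_def by metis
  have main: "\<exists>N. \<forall>n\<ge>N. (\<lambda>k. X n k - c k) \<in> Dspace s \<and> Dnorm s (\<lambda>k. X n k - c k) \<le> \<epsilon>"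
    if "\<epsilon> > 0" for \<epsilon>
  proof -
    from Cauchy[OF that] obtain N where
      N: "\<And>m n. m \<ge> N \<Longrightarrow> n \<ge> N \<Longrightarrow> Dnorm s (\<lambda>k. X m k - X n k) < \<epsilon>" by blast
    have "(\<lambda>k. X n k - c k) \<in> Dspace s \<and> Dnorm s (\<lambda>k. X n k - c k) \<le> \<epsilon>" if n: "n \<ge> N" for n
    proof -
      let ?u = "\<lambda>k. real k powr (2 * s) * (cmod (X n k - c k))\<^sup>2"
      have fin: "(\<Sum>k<K. ?u k) \<le> \<epsilon>\<^sup>2" for K
      proof (rule LIMSEQ_le_const2)
        show "(\<lambda>m. \<Sum>k<K. real k powr (2 * s) * (cmod (X n k - X m k))\<^sup>2) \<longlonglongrightarrow> (\<Sum>k<K. ?u k)"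
          by (intro tendsto_intros c)
        show "\<exists>M. \<forall>m\<ge>M. (\<Sum>k<K. real k powr (2 * s) * (cmod (X n k - X m k))\<^sup>2) \<le> \<epsilon>\<^sup>2"
        proof (intro exI[of _ N] allI impI)
          fix m assume "m \<ge> N"
          have D: "(\<lambda>k. X n k - X m k) \<in> Dspace s" by (intro Dspace_diff X)
          have "(\<Sum>k<K. real k powr (2 * s) * (cmod (X n k - X m k))\<^sup>2) \<le>
              (\<Sum>k. real k powr (2 * s) * (cmod (X n k - X m k))\<^sup>2)"
            by (rule sum_le_suminf[OF DspaceD(1)[OF D]]) auto
          also have "\<dots> = (Dnorm s (\<lambda>k. X n k - X m k))\<^sup>2"
            unfolding Dnorm_def
            by (subst real_sqrt_pow2) (auto intro!: suminf_nonneg DspaceD(1)[OF D])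
          also have "\<dots> \<le> \<epsilon>\<^sup>2"
            using N[OF n \<open>m \<ge> N\<close>] D by (intro power_mono) auto
          finally show "(\<Sum>k<K. real k powr (2 * s) * (cmod (X n k - X m k))\<^sup>2) \<le> \<epsilon>\<^sup>2" .
        qed
      qed
      have sm: "summable ?u"
      proof (rule bounded_imp_summable[where B = "\<epsilon>\<^sup>2"])
        show "(\<Sum>k\<le>K. ?u k) \<le> \<epsilon>\<^sup>2" for K
          using fin[of "Suc K"] by (simp only: lessThan_Suc_atMost)
      qed auto
      have "(\<Sum>k. ?u k) \<le> \<epsilon>\<^sup>2"
        by (rule suminf_le_const[OF sm]) (use fin in auto)
      then have "Dnorm s (\<lambda>k. X n k - c k) \<le> \<epsilon>"
        unfolding Dnorm_def using \<open>\<epsilon> > 0\<close> by (intro real_le_lsqrt) auto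
      moreover have "c 0 = 0"
        using c[of 0] DspaceD(2)[OF X] by (simp add: LIMSEQ_const_iff)
      ultimately show ?thesis
        using sm DspaceD(2)[OF X] by (simp add: Dspace_def)
    qed
    then show ?thesis by blast
  qed
  obtain n where "(\<lambda>k. X n k - c k) \<in> Dspace s" using main[of 1] by auto
  from Dspace_diff[OF X this, of n] have "c \<in> Dspace s" by simp
  moreover have "(\<lambda>n. Dnorm s (\<lambda>k. X n k - c k)) \<longlonglongrightarrow> 0"
  proof (rule LIMSEQ_I)
    fix r :: real assume "r > 0"
    then obtain N where N: "\<forall>n\<ge>N. (\<lambda>k. X n k - c k) \<in> Dspace s \<and> Dnorm s (\<lambda>k. X n k - c k) \<le> r / 2"
      using main[of "r / 2"] by auto
    have "norm (Dnorm s (\<lambda>k. X n k - c k) - 0) < r" if "n \<ge> N" for n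
      using N[rule_format, OF that] Dnorm_nonneg[of "\<lambda>k. X n k - c k" s] \<open>r > 0\<close> by simp
    then show "\<exists>N. \<forall>n\<ge>N. norm (Dnorm s (\<lambda>k. X n k - c k) - 0) < r" by blast
  qed
  ultimately show ?thesis by blast
qed


subsection \<open>Existence, uniqueness and the explicit form of the solution\<close>

definition string_wave ::
    "real \<Rightarrow> (nat \<Rightarrow> complex) \<Rightarrow> (nat \<Rightarrow> complex) \<Rightarrow> real \<Rightarrow> nat \<Rightarrow> complex" where
  "string_wave q a b t k =
     a k * cis (sqrt ((real k)\<^sup>2 + q) * t) + b k * cis (- (sqrt ((real k)\<^sup>2 + q) * t))"

lemma norm_cis_diff_le: "cmod (cis x - cis y) \<le> \<bar>x - y\<bar>"
proof -
  have "cis x - cis y = cis y * (cis (x - y) - 1)"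
    by (simp add: right_diff_distrib cis_mult)
  then have "cmod (cis x - cis y) = cmod (cis (x - y) - 1)"
    by (simp add: norm_mult)
  also have "\<dots> = 2 * \<bar>sin ((x - y) / 2)\<bar>"
    using dist_exp_i_1[of "x - y"] by (simp add: cis_conv_exp)
  also have "\<dots> \<le> \<bar>x - y\<bar>"
    using abs_sin_x_le_abs_x[of "(x - y) / 2"] by simp
  finally show ?thesis .
qed

lemma string_wave_Dspace:
  assumes "a \<in> Dspace s" "b \<in> Dspace s"
  shows "string_wave q a b t \<in> Dspace s"
  by (rule Dspace_dominated[OF Dspace_norm_add[OF assms], where M = 1])
     (auto simp del: of_real_add simp: string_wave_def norm_mult
       intro!: norm_triangle_le)

lemma string_wave_deriv:
  "((\<lambda>t. string_wave q a b t k) has_vector_derivative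
     string_wave q (\<lambda>k. \<i> * sqrt ((real k)\<^sup>2 + q) * a k) (\<lambda>k. - (\<i> * sqrt ((real k)\<^sup>2 + q) * b k)) t k) (at t)"
  unfolding string_wave_def cis_conv_exp
  by (auto intro!: derivative_eq_intros has_vector_derivative_real_field simp: algebra_simps)

lemma has_vector_derivative_iff_quotient:
  fixes f :: "real \<Rightarrow> complex"
  shows "(f has_vector_derivative D) (at t) \<longleftrightarrow>
    ((\<lambda>h. (f (t + h) - f t) / of_real h) \<longlongrightarrow> D) (at 0)"
proof -
  have "(f has_vector_derivative D) (at t) \<longleftrightarrow>
      ((\<lambda>h. norm (f (t + h) - f t - h *\<^sub>R D) / norm h) \<longlongrightarrow> 0) (at 0)"
    by (simp add: has_vector_derivative_def has_derivative_at bounded_linear_scaleR_left)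
  also have "\<dots> \<longleftrightarrow> ((\<lambda>h. norm ((f (t + h) - f t) / of_real h - D)) \<longlongrightarrow> 0) (at 0)"
  proof (rule filterlim_cong[OF refl refl])
    have "norm (f (t + h) - f t - h *\<^sub>R D) / norm h = norm ((f (t + h) - f t) / of_real h - D)"
      if "h \<noteq> 0" for h :: real
    proof -
      have "(f (t + h) - f t) / of_real h - D = (f (t + h) - f t - h *\<^sub>R D) / of_real h"
        using that by (simp add: scaleR_conv_of_real field_simps)
      then show ?thesis by (simp add: norm_divide)
    qed
    then show "\<forall>\<^sub>F h in at 0. norm (f (t + h) - f t - h *\<^sub>R D) / norm h =
        norm ((f (t + h) - f t) / of_real h - D)"
      by (simp add: eventually_at_filter)
  qed
  finally show ?thesis
    by (simp add: tendsto_norm_zero_iff LIM_zero_iff)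
qed

lemma string_wave_continuous:
  assumes "a \<in> Dspace s" "b \<in> Dspace s"
  shows "D_continuous s (string_wave q a b)"
  unfolding D_continuous_def
proof (intro conjI allI)
  fix t
  show "((\<lambda>\<tau>. Dnorm s (\<lambda>k. string_wave q a b \<tau> k - string_wave q a b t k)) \<longlongrightarrow> 0) (at t)"
  proof (rule Dnorm_tendsto_dominated[OF _ _ Dspace_norm_add[OF assms], where M = 2])
    fix k
    have "isCont (\<lambda>\<tau>. string_wave q a b \<tau> k) t"
      using has_vector_derivative_continuous[OF string_wave_deriv] .
    then show "((\<lambda>\<tau>. string_wave q a b \<tau> k - string_wave q a b t k) \<longlongrightarrow> 0) (at t)"
      by (simp add: isCont_def LIM_zero)
  next
    fix \<tau> k
    have *: "cmod (string_wave q a b u k) \<le> cmod (a k) + cmod (b k)" for u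
      by (auto simp: string_wave_def norm_mult intro!: norm_triangle_le)
    show "cmod (string_wave q a b \<tau> k - string_wave q a b t k) \<le>
        2 * cmod (of_real (cmod (a k) + cmod (b k)))"
      using norm_triangle_ineq4[of "string_wave q a b \<tau> k" "string_wave q a b t k"] *[of \<tau>] *[of t]
      by (simp del: of_real_add)
  qed simp
qed (intro string_wave_Dspace assms)

lemma sqrt_freq_le: "sqrt ((real k)\<^sup>2 + q) \<le> sqrt (1 + q) * real k" if "k \<ge> 1" "q \<ge> 0"
proof -
  have "1 \<le> (real k)\<^sup>2" using that by simp
  then have "(real k)\<^sup>2 + q \<le> (1 + q) * (real k)\<^sup>2"
    using mult_left_mono[of 1 "(real k)\<^sup>2" q] that by (simp add: algebra_simps)
  then have "sqrt ((real k)\<^sup>2 + q) \<le> sqrt ((1 + q) * (real k)\<^sup>2)" by simp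
  then show ?thesis by (simp add: real_sqrt_mult)
qed

lemma freq_mult_Dspace:
  assumes "a \<in> Dspace s" "q \<ge> 0" "cmod z = 1"
  shows "(\<lambda>k. z * sqrt ((real k)\<^sup>2 + q) * a k) \<in> Dspace (s - 1)"
proof (rule Dspace_dominated[where M = "sqrt (1 + q)" and g = "\<lambda>k. of_nat k * a k"])
  have "real k powr (2 * (s - 1)) * (cmod (of_nat k * a k))\<^sup>2 = real k powr (2 * s) * (cmod (a k))\<^sup>2" for k
    by (cases "k = 0")
       (auto simp: norm_mult power_mult_distrib right_diff_distrib powr_diff powr_numeral)
  then show "(\<lambda>k. of_nat k * a k) \<in> Dspace (s - 1)"
    using assms(1) by (simp add: Dspace_def)
next
  fix k
  show "cmod (z * sqrt ((real k)\<^sup>2 + q) * a k) \<le> sqrt (1 + q) * cmod (of_nat k * a k)"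
  proof (cases "k = 0")
    case True
    then show ?thesis using DspaceD(2)[OF assms(1)] by simp
  next
    case False
    then have "sqrt ((real k)\<^sup>2 + q) * cmod (a k) \<le> sqrt (1 + q) * real k * cmod (a k)"
      using sqrt_freq_le[of k q] assms(2) by (intro mult_right_mono) auto
    then show ?thesis using assms by (simp add: norm_mult mult_ac)
  qed
qed

lemma Dspace_minus1:
  assumes "a \<in> Dspace s"
  shows "a \<in> Dspace (s - 1)"
proof -
  have "(\<lambda>k. (1::complex) * sqrt ((real k)\<^sup>2 + 0) * a k) \<in> Dspace (s - 1)"
    by (rule freq_mult_Dspace[OF assms]) auto
  then show ?thesis
  proof (rule Dspace_dominated[where M = 1])
    fix k
    show "cmod (a k) \<le> 1 * cmod (1 * complex_of_real (sqrt ((real k)\<^sup>2 + 0)) * a k)"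
      using DspaceD(2)[OF assms] mult_right_mono[of 1 "real k" "cmod (a k)"]
      by (cases "k = 0") (auto simp: norm_mult)
  qed
qed

lemma string_wave_has_derivative:
  assumes a: "a \<in> Dspace s" and b: "b \<in> Dspace s" and q: "q \<ge> 0"
  shows "D_has_derivative (s - 1) (string_wave q a b)
    (string_wave q (\<lambda>k. \<i> * sqrt ((real k)\<^sup>2 + q) * a k) (\<lambda>k. - (\<i> * sqrt ((real k)\<^sup>2 + q) * b k)))"
    (is "D_has_derivative _ _ (string_wave q ?a ?b)")
proof -
  have a': "?a \<in> Dspace (s - 1)"
    by (rule freq_mult_Dspace) (use a q in auto)
  have b': "?b \<in> Dspace (s - 1)"
    using freq_mult_Dspace[OF b q, of "- \<i>"] by simp
  show ?thesis
    unfolding D_has_derivative_def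
  proof (intro conjI allI)
    fix t
    show "((\<lambda>h. Dnorm (s - 1) (\<lambda>k. (string_wave q a b (t + h) k - string_wave q a b t k) / of_real h
        - string_wave q ?a ?b t k)) \<longlongrightarrow> 0) (at 0)"
    proof (rule Dnorm_tendsto_dominated[OF _ _ Dspace_norm_add[OF a' b'], where M = 2])
      fix k
      show "((\<lambda>h. (string_wave q a b (t + h) k - string_wave q a b t k) / of_real h
          - string_wave q ?a ?b t k) \<longlongrightarrow> 0) (at 0)"
        using string_wave_deriv[of q a b k t]
        unfolding has_vector_derivative_iff_quotient by (rule LIM_zero)
    next
      fix h k
      let ?w = "sqrt ((real k)\<^sup>2 + q)"
      have w0: "?w \<ge> 0" using q by simp
      have 1: "cmod (string_wave q ?a ?b t k) \<le> ?w * cmod (a k) + ?w * cmod (b k)"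
        unfolding string_wave_def
        by (rule norm_triangle_le) (use w0 in \<open>simp add: norm_mult\<close>)
      have "cmod (string_wave q a b (t + h) k - string_wave q a b t k) =
          cmod (a k * (cis (?w * (t + h)) - cis (?w * t)) + b k * (cis (- (?w * (t + h))) - cis (- (?w * t))))"
        by (simp add: string_wave_def algebra_simps)
      also have "\<dots> \<le> cmod (a k) * cmod (cis (?w * (t + h)) - cis (?w * t)) +
          cmod (b k) * cmod (cis (- (?w * (t + h))) - cis (- (?w * t)))"
        unfolding norm_mult[symmetric] by (rule norm_triangle_ineq)
      also have "\<dots> \<le> cmod (a k) * (?w * \<bar>h\<bar>) + cmod (b k) * (?w * \<bar>h\<bar>)"
      proof -
        have "\<bar>?w * (t + h) - ?w * t\<bar> = ?w * \<bar>h\<bar>" "\<bar>- (?w * (t + h)) - - (?w * t)\<bar> = ?w * \<bar>h\<bar>"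
          using w0 by (simp_all add: algebra_simps abs_mult)
        then show ?thesis
          using norm_cis_diff_le[of "?w * (t + h)" "?w * t"]
            norm_cis_diff_le[of "- (?w * (t + h))" "- (?w * t)"]
          by (intro add_mono mult_left_mono) auto
      qed
      finally have "cmod (string_wave q a b (t + h) k - string_wave q a b t k) \<le>
          (?w * cmod (a k) + ?w * cmod (b k)) * \<bar>h\<bar>"
        by (simp add: algebra_simps)
      then have 2: "cmod ((string_wave q a b (t + h) k - string_wave q a b t k) / of_real h) \<le>
          ?w * cmod (a k) + ?w * cmod (b k)"
        using w0 by (cases "h = 0") (simp_all add: norm_divide divide_le_eq)
      have "cmod (complex_of_real (cmod (?a k) + cmod (?b k))) = ?w * cmod (a k) + ?w * cmod (b k)"
        using w0 by (simp del: of_real_add add: norm_mult)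
      then show "cmod ((string_wave q a b (t + h) k - string_wave q a b t k) / of_real h
          - string_wave q ?a ?b t k) \<le> 2 * cmod (complex_of_real (cmod (?a k) + cmod (?b k)))"
        using norm_triangle_ineq4[of "(string_wave q a b (t + h) k - string_wave q a b t k) / of_real h"
            "string_wave q ?a ?b t k"] 1 2 by linarith
    qed simp
  next
    show "string_wave q a b t \<in> Dspace (s - 1)" for t
      by (rule string_wave_Dspace[OF Dspace_minus1[OF a] Dspace_minus1[OF b]])
    show "string_wave q ?a ?b t \<in> Dspace (s - 1)" for t
      by (rule string_wave_Dspace[OF a' b'])
  qed
qed

lemma D_has_derivative_coord:
  assumes "D_has_derivative s f g"
  shows "((\<lambda>t. f t k) has_vector_derivative g t k) (at t)"
proof (cases "k \<ge> 1")
  case True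
  have f: "f u \<in> Dspace s" and g: "g u \<in> Dspace s" for u
    using assms by (auto simp: D_has_derivative_def)
  let ?Q = "\<lambda>h k. (f (t + h) k - f t k) / of_real h - g t k"
  have Q: "?Q h \<in> Dspace s" for h
    by (intro Dspace_diff g Dspace_dominated[OF Dspace_diff[OF f[of "t + h"] f[of t]], where M = "inverse \<bar>h\<bar>"])
       (simp add: norm_mult norm_inverse divide_inverse_commute)
  have "((\<lambda>h. real k powr (- s) * Dnorm s (?Q h)) \<longlongrightarrow> real k powr (- s) * 0) (at 0)"
    using assms by (intro tendsto_intros) (auto simp: D_has_derivative_def)
  then have "((\<lambda>h. ?Q h k) \<longlongrightarrow> 0) (at 0)"
    by (rule_tac Lim_null_comparison[rotated])
       (auto intro!: always_eventually cmod_le_Dnorm[OF Q True])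
  then have "((\<lambda>h. (f (t + h) k - f t k) / of_real h) \<longlongrightarrow> g t k) (at 0)"
    by (rule LIM_zero_cancel)
  then show ?thesis
    by (simp add: has_vector_derivative_iff_quotient)
next
  case False
  then have k: "k = 0" by simp
  have f: "f u 0 = 0" and g: "g u 0 = 0" for u
    using assms by (auto simp: D_has_derivative_def Dspace_def)
  show ?thesis unfolding k f g by simp
qed

lemma div_freq_Dspace:
  assumes "c \<in> Dspace (s - 1)" "q \<ge> 0"
  shows "(\<lambda>k. c k / (\<i> * sqrt ((real k)\<^sup>2 + q))) \<in> Dspace s"
proof (rule Dspace_dominated[where M = 1 and g = "\<lambda>k. c k / of_nat k"])
  have "real k powr (2 * s) * (cmod (c k / of_nat k))\<^sup>2 = real k powr (2 * (s - 1)) * (cmod (c k))\<^sup>2" for k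
    by (cases "k = 0")
       (auto simp: norm_divide power_divide right_diff_distrib powr_diff powr_numeral)
  then show "(\<lambda>k. c k / of_nat k) \<in> Dspace s"
    using assms(1) by (simp add: Dspace_def)
next
  fix k
  show "cmod (c k / (\<i> * sqrt ((real k)\<^sup>2 + q))) \<le> 1 * cmod (c k / of_nat k)"
  proof (cases "k = 0")
    case True
    then show ?thesis using DspaceD(2)[OF assms(1)] by simp
  next
    case False
    have "real k \<le> sqrt ((real k)\<^sup>2 + q)"
      using assms(2) by (intro real_le_rsqrt) simp
    then have "cmod (c k) / sqrt ((real k)\<^sup>2 + q) \<le> cmod (c k) / real k"
      using False by (intro divide_left_mono mult_pos_pos) (use assms(2) in \<open>auto simp: add_pos_nonneg\<close>)
    then show ?thesis using assms(2) by (simp add: norm_divide norm_mult)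
  qed
qed

lemma has_vector_derivative_cis:
  "((\<lambda>t. cis (w * t)) has_vector_derivative (\<i> * of_real w * cis (w * t))) (at t)"
  unfolding cis_conv_exp
  by (auto intro!: derivative_eq_intros has_vector_derivative_real_field simp: algebra_simps)

lemma oscillator_unique:
  fixes Y V W :: "real \<Rightarrow> complex"
  assumes w: "w > 0"
    and Y: "\<And>t. (Y has_vector_derivative V t) (at t)"
    and V: "\<And>t. (V has_vector_derivative W t) (at t)"
    and W: "\<And>t. W t = - (of_real w)\<^sup>2 * Y t"
  shows "Y t = (Y 0 + V 0 / (\<i> * w)) / 2 * cis (w * t) + (Y 0 - V 0 / (\<i> * w)) / 2 * cis (- (w * t))"
proof -
  have const: "(V t + \<i> * of_real u * Y t) * cis (- u * t) = V 0 + \<i> * of_real u * Y 0"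
    if u: "u\<^sup>2 = w\<^sup>2" for u :: real
  proof -
    have u2: "(complex_of_real u)\<^sup>2 = (complex_of_real w)\<^sup>2"
      using u by (metis of_real_power)
    have "((\<lambda>t. (V t + \<i> * of_real u * Y t) * cis (- u * t)) has_vector_derivative 0) (at t)" for t
    proof (rule has_vector_derivative_eq_rhs)
      show "((\<lambda>t. (V t + \<i> * of_real u * Y t) * cis (- u * t)) has_vector_derivative
          ((V t + \<i> * of_real u * Y t) * (\<i> * of_real (- u) * cis (- u * t)) +
           (W t + \<i> * of_real u * V t) * cis (- u * t))) (at t)"
        by (intro has_vector_derivative_mult has_vector_derivative_add V
            has_vector_derivative_mult_right Y has_vector_derivative_cis)
      have "W t = - (of_real u)\<^sup>2 * Y t" using W u2 by simp
      then show "(V t + \<i> * of_real u * Y t) * (\<i> * of_real (- u) * cis (- u * t)) +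
           (W t + \<i> * of_real u * V t) * cis (- u * t) = 0"
        by (simp add: algebra_simps power2_eq_square)
    qed
    then obtain C where C: "\<And>t. (V t + \<i> * of_real u * Y t) * cis (- u * t) = C"
      using has_vector_derivative_zero_constant[of UNIV "\<lambda>t. (V t + \<i> * of_real u * Y t) * cis (- u * t)"]
      by auto
    show ?thesis using C[of t] C[of 0] by simp
  qed
  have cc: "cis (- (w * t)) * cis (w * t) = 1" "cis (w * t) * cis (- (w * t)) = 1"
    by (simp_all add: cis_mult)
  have A: "V t + \<i> * of_real w * Y t = (V 0 + \<i> * of_real w * Y 0) * cis (w * t)"
    using const[of w] cc by (metis mult.assoc mult.right_neutral mult_minus_left)
  have "V t - \<i> * of_real w * Y t = (V 0 - \<i> * of_real w * Y 0) * cis (- (w * t))"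
  proof -
    have "(V t - \<i> * of_real w * Y t) * cis (w * t) = V 0 - \<i> * of_real w * Y 0"
      using const[of "- w"] by simp
    then have "(V t - \<i> * of_real w * Y t) * (cis (w * t) * cis (- (w * t))) =
        (V 0 - \<i> * of_real w * Y 0) * cis (- (w * t))"
      by (simp flip: mult.assoc)
    then show ?thesis by (simp only: cc mult_1_right)
  qed
  note B = this
  define d where "d = \<i> * complex_of_real w"
  have d0: "d \<noteq> 0" using w by (simp add: d_def)
  have "2 * (d * Y t) = (V t + d * Y t) - (V t - d * Y t)" by simp
  also have "\<dots> = (V 0 + d * Y 0) * cis (w * t) - (V 0 - d * Y 0) * cis (- (w * t))"
    using A B by (simp only: d_def)
  finally have "Y t = ((V 0 + d * Y 0) * cis (w * t) - (V 0 - d * Y 0) * cis (- (w * t))) / (2 * d)"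
    using d0 by (simp add: field_simps)
  also have "\<dots> = (Y 0 + V 0 / d) / 2 * cis (w * t) + (Y 0 - V 0 / d) / 2 * cis (- (w * t))"
    using d0 by (simp add: field_simps)
  finally show ?thesis by (simp only: d_def)
qed

theorem string_solution_iff:
  assumes q: "q \<ge> 0" and y0: "y0 \<in> Dspace \<sigma>" and y1: "y1 \<in> Dspace (\<sigma> - 1)"
  shows "string_solution q \<sigma> y0 y1 y \<longleftrightarrow>
    y = string_wave q (\<lambda>k. (y0 k + y1 k / (\<i> * sqrt ((real k)\<^sup>2 + q))) / 2)
                      (\<lambda>k. (y0 k - y1 k / (\<i> * sqrt ((real k)\<^sup>2 + q))) / 2)"
    (is "_ \<longleftrightarrow> y = string_wave q ?a ?b")
proof
  assume "string_solution q \<sigma> y0 y1 y"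
  then obtain v w where c: "D_continuous \<sigma> y" and d1: "D_has_derivative (\<sigma> - 1) y v"
    and d2: "D_has_derivative (\<sigma> - 2) v w"
    and eq: "\<And>t k. w t k - D_xx (y t) k + of_real q * y t k = 0"
    and init: "y 0 = y0" "v 0 = y1"
    unfolding string_solution_def by blast
  show "y = string_wave q ?a ?b"
  proof (intro ext)
    fix t k
    show "y t k = string_wave q ?a ?b t k"
    proof (cases "k = 0")
      case True
      then show ?thesis
        using c y0 y1 by (simp add: D_continuous_def Dspace_def string_wave_def)
    next
      case False
      then have pos: "(real k)\<^sup>2 + q > 0"
        using q by (simp add: add_pos_nonneg)
      have "w u k = - (of_real (sqrt ((real k)\<^sup>2 + q)))\<^sup>2 * y u k" for u
      proof -
        have "(complex_of_real (sqrt ((real k)\<^sup>2 + q)))\<^sup>2 = of_nat k ^ 2 + of_real q"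
          using pos by (simp add: of_real_power[symmetric] del: of_real_power) simp
        moreover have "w u k = - (of_nat k ^ 2 + of_real q) * y u k"
          using eq[of u k] by (simp add: D_xx_def algebra_simps eq_neg_iff_add_eq_0)
        ultimately show ?thesis by simp
      qed
      from oscillator_unique[OF _ D_has_derivative_coord[OF d1, where k = k]
          D_has_derivative_coord[OF d2, where k = k] this, where t = t]
      show ?thesis
        using pos by (simp add: init string_wave_def)
    qed
  qed
next
  assume y: "y = string_wave q ?a ?b"
  let ?f = "\<lambda>k. complex_of_real (sqrt ((real k)\<^sup>2 + q))"
  have z: "(\<lambda>k. y1 k / (\<i> * ?f k)) \<in> Dspace \<sigma>"
    by (rule div_freq_Dspace[OF y1 q])
  have a: "?a \<in> Dspace \<sigma>"
  proof (rule Dspace_dominated[OF Dspace_norm_add[OF y0 z], where M = 1])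
    fix k
    have "cmod (?a k) \<le> cmod (y0 k + y1 k / (\<i> * ?f k))"
      by (simp add: norm_divide)
    also have "\<dots> \<le> cmod (y0 k) + cmod (y1 k / (\<i> * ?f k))"
      by (rule norm_triangle_ineq)
    finally show "cmod (?a k) \<le> 1 * cmod (complex_of_real (cmod (y0 k) + cmod (y1 k / (\<i> * ?f k))))"
      by (simp del: of_real_add)
  qed
  have b: "?b \<in> Dspace \<sigma>"
    by (rule Dspace_dominated[OF Dspace_diff[OF y0 z], where M = 1]) (simp add: norm_divide)
  have a': "(\<lambda>k. \<i> * ?f k * ?a k) \<in> Dspace (\<sigma> - 1)"
    by (rule freq_mult_Dspace) (use a q in auto)
  have b': "(\<lambda>k. - (\<i> * ?f k * ?b k)) \<in> Dspace (\<sigma> - 1)"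
    using freq_mult_Dspace[OF b q, of "- \<i>"] by simp
  have a'': "(\<lambda>k. \<i> * ?f k * (\<i> * ?f k * ?a k)) \<in> Dspace (\<sigma> - 1 - 1)"
    by (rule freq_mult_Dspace) (use a' q in auto)
  have b'': "(\<lambda>k. - (\<i> * ?f k * (- (\<i> * ?f k * ?b k)))) \<in> Dspace (\<sigma> - 1 - 1)"
    using freq_mult_Dspace[OF b' q, of "- \<i>"] by simp
  have s2: "\<sigma> - 2 = \<sigma> - 1 - 1" by simp
  have f2: "(?f k)\<^sup>2 = of_nat k ^ 2 + of_real q" for k
    using q by (simp add: of_real_power[symmetric] del: of_real_power) simp
  show "string_solution q \<sigma> y0 y1 y"
    unfolding string_solution_def s2
  proof (intro exI conjI allI)
    show "D_continuous \<sigma> y"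
      unfolding y by (rule string_wave_continuous[OF a b])
    show "D_has_derivative (\<sigma> - 1) y (string_wave q (\<lambda>k. \<i> * ?f k * ?a k) (\<lambda>k. - (\<i> * ?f k * ?b k)))"
      unfolding y by (rule string_wave_has_derivative[OF a b q])
    show "D_continuous (\<sigma> - 1) (string_wave q (\<lambda>k. \<i> * ?f k * ?a k) (\<lambda>k. - (\<i> * ?f k * ?b k)))"
      by (rule string_wave_continuous[OF a' b'])
    show "D_has_derivative (\<sigma> - 1 - 1) (string_wave q (\<lambda>k. \<i> * ?f k * ?a k) (\<lambda>k. - (\<i> * ?f k * ?b k)))
        (string_wave q (\<lambda>k. \<i> * ?f k * (\<i> * ?f k * ?a k)) (\<lambda>k. - (\<i> * ?f k * (- (\<i> * ?f k * ?b k)))))"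
      by (rule string_wave_has_derivative[OF a' b' q])
    show "D_continuous (\<sigma> - 1 - 1)
        (string_wave q (\<lambda>k. \<i> * ?f k * (\<i> * ?f k * ?a k)) (\<lambda>k. - (\<i> * ?f k * (- (\<i> * ?f k * ?b k)))))"
      by (rule string_wave_continuous[OF a'' b''])
    show "string_wave q (\<lambda>k. \<i> * ?f k * (\<i> * ?f k * ?a k)) (\<lambda>k. - (\<i> * ?f k * (- (\<i> * ?f k * ?b k)))) t k
        - D_xx (y t) k + of_real q * y t k = 0" for t k
    proof -
      have *: "\<i> * F * (\<i> * F * A) * E1 + - (\<i> * F * - (\<i> * F * B)) * E2
          - (- K * (A * E1 + B * E2)) + Q * (A * E1 + B * E2) = 0"
        if "F\<^sup>2 = K + Q" for A B E1 E2 F K Q :: complex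
      proof -
        have ff: "\<i> * F * (\<i> * F * c) = - (K + Q) * c" for c
        proof -
          have "\<i> * F * (\<i> * F * c) = - (F\<^sup>2) * c"
            by (simp add: complex_eq_iff power2_eq_square algebra_simps)
          then show ?thesis by (simp only: that)
        qed
        show ?thesis
          unfolding mult_minus_right minus_minus ff by (simp add: algebra_simps)
      qed
      show ?thesis
        unfolding y string_wave_def D_xx_def by (rule *[OF f2])
    qed
    show "y 0 = y0"
      unfolding y by (rule ext) (simp add: string_wave_def flip: add_divide_distrib)
    show "string_wave q (\<lambda>k. \<i> * ?f k * ?a k) (\<lambda>k. - (\<i> * ?f k * ?b k)) 0 = y1"
    proof
      fix k
      show "string_wave q (\<lambda>k. \<i> * ?f k * ?a k) (\<lambda>k. - (\<i> * ?f k * ?b k)) 0 k = y1 k"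
      proof (cases "k = 0")
        case True
        then show ?thesis
          using DspaceD(2)[OF y0] DspaceD(2)[OF y1] by (simp add: string_wave_def)
      next
        case False
        then have "?f k \<noteq> 0"
          using q by (simp add: add_pos_nonneg less_imp_neq[symmetric])
        then have "\<i> * ?f k \<noteq> 0" by simp
        moreover have "d * ((u + v / d) / 2) + - (d * ((u - v / d) / 2)) = v"
          if "d \<noteq> 0" for d u v :: complex
          using that by (simp add: field_simps)
        ultimately show ?thesis by (simp only: string_wave_def) simp
      qed
    qed
  qed
qed

end

theory Submission
  imports Defs
begin

text \<open>
  Each coefficient of a solution oscillates with its own frequency \<open>\<omega> = sqrt (k\<^sup>2 + q)\<close>, so
  recovering \<open>(y0, y1)\<close> from \<open>(y(t0), y(t1))\<close> splits into independent \<open>2 \<times> 2\<close> linear systems,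
  whose determinants are \<open>2 \<i> sin (\<omega> (t0 - t1))\<close>.  Inverting such a system therefore costs a
  factor \<open>1 / \<bar>sin (\<omega> (t0 - t1))\<bar>\<close>, and an observability inequality that loses one derivative
  tolerates a factor of order \<open>k\<close> and no more.  This shows, for every \<open>q \<ge> 0\<close>, that a pair is
  strategic if and only if \<open>\<bar>sin (\<omega> (t0 - t1))\<bar>\<close> is bounded below by a positive multiple of \<open>1 / k\<close>
  (\<open>strategic_pair_iff\<close>): sufficiency is the inversion of the systems, and necessity is seen on
  the standing waves that vanish at time \<open>t1\<close>.

  In passing from the classical to the loaded string the frequencies move by at most
  \<open>q / (2 * k)\<close>.  The sine is Lipschitz, so the determinants move by \<open>O(q / k)\<close>, which is exactly
  the order of the lower bound; for small \<open>q\<close> half of the bound survives.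
\<close>

section \<open>Norm estimates\<close>

lemma Dspace_term_eq: "real k powr (2 * s) * (cmod z)\<^sup>2 = (real k powr s * cmod z)\<^sup>2"
  by (simp add: power_mult_distrib power2_eq_square flip: powr_add)

text \<open>
  Turns a bound on every single mode into a bound of Sobolev norms.  The factor \<open>2\<close> is not
  sharp; with it, \<open>(x + y)\<^sup>2 \<le> 2 * (x\<^sup>2 + y\<^sup>2)\<close> takes the place of Minkowski's inequality.
\<close>

lemma Dnorm_le_of_weighted_bound:
  assumes g: "g \<in> Dspace r" and h: "h \<in> Dspace r" and M: "M \<ge> 0"
    and bound: "\<And>k. real k powr s * cmod (f k) \<le> M * (real k powr r * (cmod (g k) + cmod (h k)))"
  shows "Dnorm s f \<le> 2 * M * (Dnorm r g + Dnorm r h)"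
proof -
  let ?F = "\<lambda>k. real k powr (2 * s) * (cmod (f k))\<^sup>2"
  let ?G = "\<lambda>k. real k powr (2 * r) * (cmod (g k))\<^sup>2"
  let ?H = "\<lambda>k. real k powr (2 * r) * (cmod (h k))\<^sup>2"
  have sG: "summable ?G" and sH: "summable ?H" using g h by (auto dest: DspaceD)
  have pw: "?F k \<le> 2 * M\<^sup>2 * (?G k + ?H k)" for k
  proof -
    let ?a = "real k powr r * cmod (g k)" and ?b = "real k powr r * cmod (h k)"
    have "?F k \<le> (M * (?a + ?b))\<^sup>2"
      unfolding Dspace_term_eq using bound[of k] by (intro power_mono) (auto simp: algebra_simps)
    also have "\<dots> = M\<^sup>2 * (?a + ?b)\<^sup>2" by (simp add: power_mult_distrib)
    also have "\<dots> \<le> M\<^sup>2 * (2 * (?a\<^sup>2 + ?b\<^sup>2))"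
      using zero_le_power2[of "?a - ?b"]
      by (intro mult_left_mono) (simp_all only: power2_sum power2_diff, auto)
    also have "\<dots> = 2 * M\<^sup>2 * (?a\<^sup>2 + ?b\<^sup>2)" by simp
    finally show ?thesis unfolding Dspace_term_eq .
  qed
  have sR: "summable (\<lambda>k. 2 * M\<^sup>2 * (?G k + ?H k))"
    by (intro summable_mult summable_add sG sH)
  have sF: "summable ?F"
    by (rule summable_comparison_test'[OF sR, of 0]) (use pw in simp)
  have sq: "(\<Sum>k. ?G k) = (Dnorm r g)\<^sup>2" "(\<Sum>k. ?H k) = (Dnorm r h)\<^sup>2"
    unfolding Dnorm_def by (simp_all add: suminf_nonneg sG sH)
  have nn: "Dnorm r g \<ge> 0" "Dnorm r h \<ge> 0" using g h by auto
  have "(\<Sum>k. ?F k) \<le> (\<Sum>k. 2 * M\<^sup>2 * (?G k + ?H k))"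
    by (rule suminf_le[OF pw sF sR])
  also have "\<dots> = 2 * M\<^sup>2 * ((Dnorm r g)\<^sup>2 + (Dnorm r h)\<^sup>2)"
    by (simp add: suminf_mult suminf_add[symmetric] sG sH summable_add sq)
  also have "\<dots> \<le> 4 * M\<^sup>2 * (Dnorm r g + Dnorm r h)\<^sup>2"
  proof -
    have "(Dnorm r g)\<^sup>2 + (Dnorm r h)\<^sup>2 \<le> 2 * (Dnorm r g + Dnorm r h)\<^sup>2"
      using nn by (simp add: power2_sum)
    then have "2 * M\<^sup>2 * ((Dnorm r g)\<^sup>2 + (Dnorm r h)\<^sup>2) \<le> 2 * M\<^sup>2 * (2 * (Dnorm r g + Dnorm r h)\<^sup>2)"
      by (intro mult_left_mono) auto
    then show ?thesis by simp
  qed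
  also have "\<dots> = (2 * M * (Dnorm r g + Dnorm r h))\<^sup>2" by (simp add: power_mult_distrib)
  finally show ?thesis
    unfolding Dnorm_def[of s] using nn M by (intro real_le_lsqrt) auto
qed

lemma single_mode_Dspace: "k \<ge> 1 \<Longrightarrow> (\<lambda>j. if j = k then c else 0) \<in> Dspace s"
  by (rule subsetD[OF sine_polys_subset_Dspace]) (auto simp: sine_polys_def)

lemma Dnorm_single_mode: "Dnorm s (\<lambda>j. if j = k then c else 0) = real k powr s * cmod c"
proof -
  have "(\<Sum>j. real j powr (2 * s) * (cmod (if j = k then c else 0))\<^sup>2) =
      (\<Sum>j\<in>{k}. real j powr (2 * s) * (cmod (if j = k then c else 0))\<^sup>2)"
    by (rule suminf_finite) auto
  then show ?thesis unfolding Dnorm_def by (simp add: Dspace_term_eq)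
qed

section \<open>Characterisation of strategic pairs\<close>

text \<open>
  Cramer's rule for the system \<open>a cis (w t0) + b cis (- w t0) = u\<close>,
  \<open>a cis (w t1) + b cis (- w t1) = v\<close>: eliminating one amplitude leaves the other multiplied by
  the determinant, while \<open>u\<close> and \<open>v\<close> are only multiplied by numbers of modulus one.
\<close>

lemma amplitude_le_two_observations:
  fixes a b :: complex and w t0 t1 :: real
  defines "Y \<equiv> \<lambda>t. a * cis (w * t) + b * cis (- (w * t))"
  shows "2 * \<bar>sin (w * (t0 - t1))\<bar> * cmod a \<le> cmod (Y t0) + cmod (Y t1)"
    and "2 * \<bar>sin (w * (t0 - t1))\<bar> * cmod b \<le> cmod (Y t0) + cmod (Y t1)"
proof -
  have det: "cis (w * t0 - w * t1) - cis (w * t1 - w * t0) = 2 * \<i> * of_real (sin (w * (t0 - t1)))"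
  proof -
    have "w * t1 - w * t0 = - (w * (t0 - t1))" "w * t0 - w * t1 = w * (t0 - t1)"
      by (simp_all add: algebra_simps)
    then show ?thesis by (simp only:) (simp add: complex_eq_iff)
  qed
  have "Y t0 * cis (- (w * t1)) - Y t1 * cis (- (w * t0)) =
      (cis (w * t0 - w * t1) - cis (w * t1 - w * t0)) * a"
    by (simp add: Y_def algebra_simps cis_mult)
  then have "cmod (Y t0 * cis (- (w * t1)) - Y t1 * cis (- (w * t0))) =
      2 * \<bar>sin (w * (t0 - t1))\<bar> * cmod a"
    by (simp add: det norm_mult)
  then show "2 * \<bar>sin (w * (t0 - t1))\<bar> * cmod a \<le> cmod (Y t0) + cmod (Y t1)"
    using norm_triangle_ineq4[of "Y t0 * cis (- (w * t1))" "Y t1 * cis (- (w * t0))"]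
    by (simp add: norm_mult)
  have "Y t1 * cis (w * t0) - Y t0 * cis (w * t1) =
      (cis (w * t0 - w * t1) - cis (w * t1 - w * t0)) * b"
    by (simp add: Y_def algebra_simps cis_mult)
  then have "cmod (Y t1 * cis (w * t0) - Y t0 * cis (w * t1)) =
      2 * \<bar>sin (w * (t0 - t1))\<bar> * cmod b"
    by (simp add: det norm_mult)
  then show "2 * \<bar>sin (w * (t0 - t1))\<bar> * cmod b \<le> cmod (Y t0) + cmod (Y t1)"
    using norm_triangle_ineq4[of "Y t1 * cis (w * t0)" "Y t0 * cis (w * t1)"]
    by (simp add: norm_mult)
qed

text \<open>
  The amplitudes cost a factor \<open>k / c\<close>.  The displacement \<open>y0\<close> is their sum, which is
  compensated by measuring it in the norm of order \<open>s = r - 1\<close>; the velocity \<open>y1\<close> carries a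
  further factor \<open>\<omega> \<le> sqrt (1 + q) * k\<close>, compensated by the order \<open>s - 1 = r - 2\<close>.
\<close>

lemma strategic_pair_if_sine_bound:
  fixes q :: real
  assumes rs: "r - s = 1" and q: "q \<ge> 0" and c: "c > 0"
    and sine: "\<And>k::nat. k \<ge> 1 \<Longrightarrow> \<bar>sin (sqrt ((real k)\<^sup>2 + q) * (t0 - t1))\<bar> \<ge> c / real k"
  shows "strategic_pair r s q t0 t1"
proof -
  let ?w = "\<lambda>k. sqrt ((real k)\<^sup>2 + q)"
  define S where "S = sqrt (1 + q)"
  have S: "S \<ge> 0" using q by (simp add: S_def)
  have main: "Dnorm s y0 + Dnorm (s - 1) y1 \<le>
      (2 * (1 / c) + 2 * (S / c)) * (Dnorm r (y t0) + Dnorm r (y t1))"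
    if y0: "y0 \<in> Dspace r" and y1: "y1 \<in> Dspace (r - 1)" and sol: "string_solution q r y0 y1 y"
    for y0 y1 y
  proof -
    have yD: "y t \<in> Dspace r" for t
      using sol by (auto simp: string_solution_def D_continuous_def)
    define a where "a k = (y0 k + y1 k / (\<i> * ?w k)) / 2" for k
    define b where "b k = (y0 k - y1 k / (\<i> * ?w k)) / 2" for k
    have y: "y = string_wave q a b"
      using sol unfolding string_solution_iff[OF q y0 y1] a_def b_def .
    define N where "N k = cmod (y t0 k) + cmod (y t1 k)" for k
    have amp: "cmod (a k) + cmod (b k) \<le> real k / c * N k" if k: "k \<ge> 1" for k
    proof -
      let ?d = "\<bar>sin (?w k * (t0 - t1))\<bar>"
      have "2 * ?d * cmod (a k) \<le> N k" "2 * ?d * cmod (b k) \<le> N k"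
        using amplitude_le_two_observations[where w = "?w k" and a = "a k" and b = "b k"]
        by (simp_all add: y string_wave_def N_def)
      then have "?d * (cmod (a k) + cmod (b k)) \<le> N k"
        by (simp add: algebra_simps)
      moreover have "c / real k * (cmod (a k) + cmod (b k)) \<le> ?d * (cmod (a k) + cmod (b k))"
        using sine[OF k] by (intro mult_right_mono) auto
      ultimately have "c / real k * (cmod (a k) + cmod (b k)) \<le> N k" by linarith
      then show ?thesis using k c by (simp add: field_simps)
    qed
    have y0_bound: "cmod (y0 k) \<le> cmod (a k) + cmod (b k)" for k
    proof -
      have "y0 k = a k + b k" by (simp add: a_def b_def field_simps)
      then show ?thesis by (simp add: norm_triangle_ineq)
    qed
    have y1_bound: "cmod (y1 k) \<le> S * real k * (cmod (a k) + cmod (b k))" if k: "k \<ge> 1" for k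
    proof -
      have "(real k)\<^sup>2 + q > 0" using k q by (simp add: add_pos_nonneg)
      then have "\<i> * complex_of_real (?w k) \<noteq> 0" by simp
      moreover have "v = d * ((u + v / d) / 2 - (u - v / d) / 2)" if "d \<noteq> 0" for d u v :: complex
        using that by (simp add: field_simps)
      ultimately have "y1 k = (\<i> * ?w k) * (a k - b k)" unfolding a_def b_def by blast
      then have "cmod (y1 k) = ?w k * cmod (a k - b k)"
        using q by (simp add: norm_mult)
      also have "\<dots> \<le> (S * real k) * (cmod (a k) + cmod (b k))"
        using sqrt_freq_le[OF k q] S unfolding S_def
        by (intro mult_mono norm_triangle_ineq4) auto
      finally show ?thesis .
    qed
    have "Dnorm s y0 \<le> 2 * (1 / c) * (Dnorm r (y t0) + Dnorm r (y t1))"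
    proof (rule Dnorm_le_of_weighted_bound[OF yD yD])
      fix k
      show "real k powr s * cmod (y0 k) \<le> 1 / c * (real k powr r * (cmod (y t0 k) + cmod (y t1 k)))"
      proof (cases "k = 0")
        case False
        have "cmod (y0 k) \<le> real k / c * N k" using y0_bound[of k] amp[of k] False by simp
        then have "real k powr s * cmod (y0 k) \<le> real k powr s * (real k / c * N k)"
          by (intro mult_left_mono) auto
        also have "\<dots> = 1 / c * ((real k powr s * real k) * N k)" by simp
        also have "real k powr s * real k = real k powr r"
          using False rs powr_add[of "real k" s 1] by (simp add: algebra_simps)
        finally show ?thesis by (simp add: N_def)
      qed simp
    qed (use c in simp)
    moreover have "Dnorm (s - 1) y1 \<le> 2 * (S / c) * (Dnorm r (y t0) + Dnorm r (y t1))"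
    proof (rule Dnorm_le_of_weighted_bound[OF yD yD])
      fix k
      show "real k powr (s - 1) * cmod (y1 k) \<le>
          S / c * (real k powr r * (cmod (y t0 k) + cmod (y t1 k)))"
      proof (cases "k = 0")
        case False
        then have "S * real k * (cmod (a k) + cmod (b k)) \<le> S * real k * (real k / c * N k)"
          using S amp[of k] by (intro mult_left_mono) auto
        then have "cmod (y1 k) \<le> S * real k * (real k / c * N k)"
          using y1_bound[of k] False by simp
        then have "real k powr (s - 1) * cmod (y1 k) \<le>
            real k powr (s - 1) * (S * real k * (real k / c * N k))"
          by (intro mult_left_mono) auto
        also have "\<dots> = S / c * ((real k powr (s - 1) * (real k)\<^sup>2) * N k)"
          by (simp add: power2_eq_square)
        also have "real k powr (s - 1) * (real k)\<^sup>2 = real k powr r"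
        proof -
          have "r = s - 1 + 2" using rs by simp
          then show ?thesis using False by (simp only: powr_add) (simp add: powr_numeral)
        qed
        finally show ?thesis by (simp add: N_def)
      qed simp
    qed (use c S in simp)
    ultimately show ?thesis by (simp add: algebra_simps)
  qed
  have "2 * (1 / c) + 2 * (S / c) > 0" using c S by (simp add: add_pos_nonneg)
  with main show ?thesis unfolding strategic_pair_def by blast
qed

text \<open>
  The standing wave \<open>sin (\<omega> (t - t1)) sin (k x)\<close> is invisible at time \<open>t1\<close>, so only its amplitude
  \<open>\<bar>sin (\<omega> (t0 - t1))\<bar>\<close> at time \<open>t0\<close> bounds its initial data, whose size is at least
  \<open>k powr s\<close> because \<open>\<bar>sin\<bar> + \<bar>cos\<bar> \<ge> 1\<close> and \<open>\<omega> \<ge> k\<close>.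
\<close>

lemma sine_bound_if_strategic_pair:
  assumes rs: "r - s = 1" and q: "q \<ge> 0" and strat: "strategic_pair r s q t0 t1"
  shows "\<exists>c>0. \<forall>k::nat. k \<ge> 1 \<longrightarrow> \<bar>sin (sqrt ((real k)\<^sup>2 + q) * (t0 - t1))\<bar> \<ge> c / real k"
proof -
  obtain C where C: "C > 0" and obs: "\<And>y0 y1 y. y0 \<in> Dspace r \<Longrightarrow> y1 \<in> Dspace (r - 1) \<Longrightarrow>
      string_solution q r y0 y1 y \<Longrightarrow>
      Dnorm s y0 + Dnorm (s - 1) y1 \<le> C * (Dnorm r (y t0) + Dnorm r (y t1))"
    using strat unfolding strategic_pair_def by blast
  have "(1 / C) / real k \<le> \<bar>sin (sqrt ((real k)\<^sup>2 + q) * (t0 - t1))\<bar>" if k: "k \<ge> 1" for k :: nat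
  proof -
    define w where "w = sqrt ((real k)\<^sup>2 + q)"
    have wk: "w \<ge> real k" unfolding w_def using q by (intro real_le_rsqrt) simp
    have w: "w > 0" using wk k by simp
    define y0 where "y0 = (\<lambda>j. if j = k then complex_of_real (- sin (w * t1)) else 0)"
    define y1 where "y1 = (\<lambda>j. if j = k then complex_of_real (w * cos (w * t1)) else 0)"
    define y where "y t = (\<lambda>j. if j = k then complex_of_real (sin (w * (t - t1))) else 0)" for t
    have y0D: "y0 \<in> Dspace r" and y1D: "y1 \<in> Dspace (r - 1)"
      unfolding y0_def y1_def by (rule single_mode_Dspace[OF k])+
    have sol: "string_solution q r y0 y1 y"
      unfolding string_solution_iff[OF q y0D y1D]
    proof (intro ext)
      fix t j
      show "y t j = string_wave q (\<lambda>k. (y0 k + y1 k / (\<i> * sqrt ((real k)\<^sup>2 + q))) / 2)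
          (\<lambda>k. (y0 k - y1 k / (\<i> * sqrt ((real k)\<^sup>2 + q))) / 2) t j"
      proof (cases "j = k")
        case True
        have "w * (t - t1) = w * t - w * t1" by (simp add: algebra_simps)
        then show ?thesis
          using w unfolding True y_def string_wave_def y0_def y1_def w_def[symmetric]
          by (simp add: complex_eq_iff sin_diff add_divide_distrib diff_divide_distrib)
      qed (simp add: y_def string_wave_def y0_def y1_def)
    qed
    have "y t1 = (\<lambda>j. if j = k then 0 else 0)" by (auto simp: y_def)
    then have "Dnorm r (y t1) = 0" by (simp add: Dnorm_def)
    moreover have "Dnorm r (y t0) = real k powr r * \<bar>sin (w * (t0 - t1))\<bar>"
      unfolding y_def Dnorm_single_mode by (simp only: norm_of_real)
    moreover have "Dnorm s y0 = real k powr s * \<bar>sin (w * t1)\<bar>"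
      unfolding y0_def Dnorm_single_mode by (simp only: norm_of_real abs_minus_cancel)
    moreover have "Dnorm (s - 1) y1 = real k powr (s - 1) * (w * \<bar>cos (w * t1)\<bar>)"
      unfolding y1_def Dnorm_single_mode using w by (simp only: norm_of_real abs_mult)
    ultimately have ineq: "real k powr s * \<bar>sin (w * t1)\<bar> + real k powr (s - 1) * (w * \<bar>cos (w * t1)\<bar>)
        \<le> C * (real k powr r * \<bar>sin (w * (t0 - t1))\<bar>)"
      using obs[OF y0D y1D sol] by simp
    have powers: "real k powr (s - 1) * real k = real k powr s" "real k powr r = real k powr s * real k"
      using k rs powr_add[of "real k" "s - 1" 1] powr_add[of "real k" s 1]
      by (simp_all add: algebra_simps)
    have "real k powr s * 1 \<le> real k powr s * (\<bar>sin (w * t1)\<bar> + \<bar>cos (w * t1)\<bar>)"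
    proof (rule mult_left_mono)
      show "1 \<le> \<bar>sin (w * t1)\<bar> + \<bar>cos (w * t1)\<bar>"
      proof (rule power2_le_imp_le)
        have "1 + 2 * \<bar>sin (w * t1)\<bar> * \<bar>cos (w * t1)\<bar> = (\<bar>sin (w * t1)\<bar> + \<bar>cos (w * t1)\<bar>)\<^sup>2"
          by (simp add: power2_sum)
        then show "1\<^sup>2 \<le> (\<bar>sin (w * t1)\<bar> + \<bar>cos (w * t1)\<bar>)\<^sup>2"
          by (smt (verit) mult_nonneg_nonneg abs_ge_zero one_power2)
      qed simp
    qed simp
    also have "\<dots> = real k powr s * \<bar>sin (w * t1)\<bar> + real k powr (s - 1) * (real k * \<bar>cos (w * t1)\<bar>)"
      by (simp add: powers(1)[symmetric] algebra_simps)
    also have "\<dots> \<le> real k powr s * \<bar>sin (w * t1)\<bar> + real k powr (s - 1) * (w * \<bar>cos (w * t1)\<bar>)"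
      using wk by (intro add_left_mono mult_left_mono mult_right_mono) auto
    also note ineq
    finally have "real k powr s * 1 \<le> real k powr s * (C * real k * \<bar>sin (w * (t0 - t1))\<bar>)"
      by (simp add: powers(2) mult_ac)
    then have "1 \<le> C * real k * \<bar>sin (w * (t0 - t1))\<bar>"
      by (rule mult_left_le_imp_le) (use k in simp)
    then show ?thesis
      unfolding w_def using C k by (simp add: field_simps)
  qed
  then show ?thesis using C by (intro exI[of _ "1 / C"]) auto
qed

theorem strategic_pair_iff:
  assumes "r - s = 1" and "q \<ge> 0"
  shows "strategic_pair r s q t0 t1 \<longleftrightarrow>
    (\<exists>c>0. \<forall>k::nat. k \<ge> 1 \<longrightarrow> \<bar>sin (sqrt ((real k)\<^sup>2 + q) * (t0 - t1))\<bar> \<ge> c / real k)"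
  using strategic_pair_if_sine_bound[OF assms] sine_bound_if_strategic_pair[OF assms] by blast

section \<open>Small loads\<close>

lemma freq_shift_le:
  assumes "k \<ge> 1" and "q \<ge> 0"
  shows "\<bar>sqrt ((real k)\<^sup>2 + q) - real k\<bar> \<le> q / (2 * real k)"
proof -
  have "real k \<le> sqrt ((real k)\<^sup>2 + q)"
    using assms by (intro real_le_rsqrt) simp
  moreover have "sqrt ((real k)\<^sup>2 + q) \<le> real k + q / (2 * real k)"
    using assms by (intro real_le_lsqrt) (auto simp: power2_sum)
  ultimately show ?thesis by simp
qed

lemma abs_sin_diff_le: "\<bar>sin x - sin y\<bar> \<le> \<bar>x - y\<bar>" for x y :: real
  using abs_Im_le_cmod[of "cis x - cis y"] norm_cis_diff_le[of x y] by simp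

text \<open>
  The argument of the sine moves by at most \<open>q \<bar>T\<bar> / (2 * k)\<close>, hence uses up at most half of
  the bound \<open>c / k\<close> when \<open>q \<bar>T\<bar> \<le> c\<close>.
\<close>

lemma sine_bound_perturbed:
  assumes k: "k \<ge> 1" and q: "q \<ge> 0" and small: "q * \<bar>T\<bar> \<le> c"
    and sine: "\<bar>sin (real k * T)\<bar> \<ge> c / real k"
  shows "\<bar>sin (sqrt ((real k)\<^sup>2 + q) * T)\<bar> \<ge> (c / 2) / real k"
proof -
  let ?w = "sqrt ((real k)\<^sup>2 + q)"
  have "\<bar>sin (?w * T) - sin (real k * T)\<bar> \<le> \<bar>?w - real k\<bar> * \<bar>T\<bar>"
    using abs_sin_diff_le[of "?w * T" "real k * T"] by (simp add: abs_mult flip: left_diff_distrib)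
  also have "\<dots> \<le> q / (2 * real k) * \<bar>T\<bar>"
    by (intro mult_right_mono freq_shift_le k q) simp
  also have "\<dots> \<le> (c / 2) / real k"
    using small k by (simp add: field_simps)
  moreover have "c / real k = (c / 2) / real k + (c / 2) / real k" by simp
  ultimately show ?thesis using sine by linarith
qed

theorem theorem5p3:
  fixes r s t0 t1 :: real
  assumes "r - s = 1"
  shows "(strategic_pair r s 0 t0 t1 \<longleftrightarrow>
            (\<exists>c>0. \<forall>k::nat. k \<ge> 1 \<longrightarrow> \<bar>sin (real k * (t0 - t1))\<bar> \<ge> c / real k)) \<and>
         (strategic_pair r s 0 t0 t1 \<longrightarrow>
            (\<exists>q0>0. \<forall>q. 0 < q \<and> q < q0 \<longrightarrow> strategic_pair r s q t0 t1))"
proof (intro conjI impI)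
  show classical: "strategic_pair r s 0 t0 t1 \<longleftrightarrow>
      (\<exists>c>0. \<forall>k::nat. k \<ge> 1 \<longrightarrow> \<bar>sin (real k * (t0 - t1))\<bar> \<ge> c / real k)"
    using strategic_pair_iff[OF assms, of 0] by simp
  assume "strategic_pair r s 0 t0 t1"
  then obtain c where c: "c > 0"
    and sine: "\<And>k::nat. k \<ge> 1 \<Longrightarrow> \<bar>sin (real k * (t0 - t1))\<bar> \<ge> c / real k"
    unfolding classical by blast
  \<comment> \<open>The summand \<open>1\<close> only keeps the denominator positive.\<close>
  define q0 where "q0 = c / (\<bar>t0 - t1\<bar> + 1)"
  have "strategic_pair r s q t0 t1" if q: "0 < q" "q < q0" for q
  proof (rule strategic_pair_if_sine_bound[OF assms])
    have "q * (\<bar>t0 - t1\<bar> + 1) < c"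
      using q by (simp add: q0_def field_simps)
    then have "q * \<bar>t0 - t1\<bar> \<le> c" using q by (simp add: distrib_left)
    then show "\<bar>sin (sqrt ((real k)\<^sup>2 + q) * (t0 - t1))\<bar> \<ge> (c / 2) / real k" if "k \<ge> 1" for k :: nat
      using sine_bound_perturbed[OF that _ _ sine[OF that]] q by simp
  qed (use c q in auto)
  moreover have "q0 > 0" using c by (simp add: q0_def add_nonneg_pos)
  ultimately show "\<exists>q0>0. \<forall>q. 0 < q \<and> q < q0 \<longrightarrow> strategic_pair r s q t0 t1" by blast
qed

end
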